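(* Let $f\in\mathcal{F}$ have the power series expansion $f(z)=z+a_2z^2+a_3z^3+\cdots$ on the unit disk $\mathbb{D}$. Then \[ |H_3(1)| \le \frac{1}{8}, \] where $H_3(1)=a_3(a_2a_4-a_3^2)-a_4(a_4-a_2a_3)+a_5(a_3-a_2^2)$ is the third order Hankel determinant of $f$.
   Context: Let $\mathbb{D}=\{z\in\mathbb{C}:|z|<1\}$ be the open unit disk. $\mathcal{A}$ denotes the class of functions $f$ analytic on $\mathbb{D}$ with expansion $f(z)=z+a_2z^2+a_3z^3+\cdots$ (i.e. $f(0)=0$, $f'(0)=1$). The class $\mathcal{F}$ of Ozaki close-to-convex functions is \[ \mathcal{F}=\left\{f\in\mathcal{A}:\ \operatorname{Re}\left[1+\frac{zf''(z)}{f'(z)}\right]>-\frac12 \text{ for all } z\in\mathbb{D}\right\}, \] where the condition includes that $f'(z)\neq 0$ for all $z\in\mathbb{D}$, so that the quotient is defined. The third order Hankel determinant of $f\in\mathcal{A}$ is \[ H_3(1)=\begin{vmatrix} 1 & a_2 & a_3\\ a_2 & a_3 & a_4\\ a_3 & a_4 & a_5\end{vmatrix}. \] *)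

theory Defs
  imports "HOL-Complex_Analysis.Complex_Analysis"
begin

text \<open>The open unit disk is \<^term>\<open>ball (0::complex) 1\<close>. Values of a function outside the
  disk are irrelevant: since the disk is open, neither \<^term>\<open>f holomorphic_on ball 0 1\<close> nor the
  derivatives at points of the disk depend on them.\<close>

definition class_A :: "(complex \<Rightarrow> complex) set" where
  "class_A = {f. f holomorphic_on ball 0 1 \<and> f 0 = 0 \<and> deriv f 0 = 1}"

text \<open>The Ozaki close-to-convex functions. Because division by zero yields zero here, the
  requirement \<^term>\<open>deriv f z \<noteq> 0\<close> has to be stated explicitly.\<close>

definition ozaki_close_to_convex :: "(complex \<Rightarrow> complex) set" where
  "ozaki_close_to_convex =
     {f \<in> class_A. \<forall>z \<in> ball 0 1.
        deriv f z \<noteq> 0 \<and> Re (1 + z * deriv (deriv f) z / deriv f z) > - 1 / 2}"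

text \<open>The third order Hankel determinant, as a function of the coefficient sequence \<open>a\<close> of a
  power series with \<open>a 1 = 1\<close>.\<close>

definition hankel_3_1 :: "(nat \<Rightarrow> complex) \<Rightarrow> complex" where
  "hankel_3_1 a =
     det (vector [vector [1,   a 2, a 3],
                  vector [a 2, a 3, a 4],
                  vector [a 3, a 4, a 5]] :: complex ^ 3 ^ 3)"

lemma hankel_3_1_expand:
  "hankel_3_1 a =
     a 3 * (a 2 * a 4 - (a 3)^2) - a 4 * (a 4 - a 2 * a 3) + a 5 * (a 3 - (a 2)^2)"
  by (simp add: hankel_3_1_def det_3 power2_eq_square algebra_simps)

end

theory Submission
  imports Defs
begin

text \<open>With \<open>q = z f'' / f'\<close> and the Schwarz function \<open>w = q / (q + 3) = b\<^sub>1 z + b\<^sub>2 z^2 + \<dots>\<close>,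
  the identity \<open>w (z f'' + 3 f') = z f''\<close> turns \<open>320 H\<^sub>3(1)\<close> into a polynomial in
  \<open>b\<^sub>1, \<dots>, b\<^sub>4\<close> whose monomials are all at least quadratic. By the triangle inequality it is
  dominated by a quadratic form in the \<open>\<bar>b\<^sub>i\<bar>\<close> that does not exceed
  \<open>40 \<Sum> \<bar>b\<^sub>i\<bar>\<^sup>2 \<le> 40\<close>.\<close>

text \<open>Cauchy's formula for the \<open>n\<close>-th derivative, parametrized over {0..1}: the
  derivative of the path cancels one of the \<open>n + 1\<close> powers in the denominator, and on
  the unit circle the inverse is the conjugate.\<close>

lemma circle_fourier_coeff:
  fixes f :: "complex \<Rightarrow> complex"
  assumes "f holomorphic_on ball 0 R" "0 < r" "r < R"
  shows "((\<lambda>t. f (of_real r * cis (2 * pi * t)) * cnj (cis (2 * pi * t)) ^ n)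
    has_integral (deriv ^^ n) f 0 / fact n * of_real r ^ n) {0..1}"
proof -
  let ?e = "\<lambda>t. cis (2 * pi * t)"
  have "((\<lambda>u. f u / (u - 0) ^ Suc n) has_contour_integral
      (2 * pi * \<i>) / fact n * (deriv ^^ n) f 0) (circlepath 0 r)"
  proof (rule Cauchy_has_contour_integral_higher_derivative_circlepath)
    show "continuous_on (cball 0 r) f"
      using assms by (intro holomorphic_on_imp_continuous_on holomorphic_on_subset[OF assms(1)]) auto
    show "f holomorphic_on ball 0 r"
      using assms by (intro holomorphic_on_subset[OF assms(1)]) auto
  qed (use assms in auto)
  then have "((\<lambda>t. f (circlepath 0 r t) / (circlepath 0 r t) ^ Suc n *
       vector_derivative (circlepath 0 r) (at t within {0..1}))
     has_integral (2 * pi * \<i>) / fact n * (deriv ^^ n) f 0) {0..1}"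
    by (simp add: has_contour_integral_def)
  \<comment> \<open>This factor cancels the constant in Cauchy's formula and the power of
    \<open>r\<close> left in the denominator.\<close>
  then have "((\<lambda>t. of_real r ^ n / (2 * pi * \<i>) * (f (circlepath 0 r t) / (circlepath 0 r t) ^ Suc n *
       vector_derivative (circlepath 0 r) (at t within {0..1})))
     has_integral of_real r ^ n / (2 * pi * \<i>) * ((2 * pi * \<i>) / fact n * (deriv ^^ n) f 0)) {0..1}"
    by (rule has_integral_mult_right)
  moreover have "of_real r ^ n / (2 * pi * \<i>) * (f (circlepath 0 r t) / (circlepath 0 r t) ^ Suc n *
       vector_derivative (circlepath 0 r) (at t within {0..1}))
     = f (of_real r * ?e t) * cnj (?e t) ^ n" if "t \<in> {0..1}" for t
  proof -
    have e: "exp (2 * of_real pi * \<i> * of_real t) = ?e t"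
      by (simp add: cis_conv_exp mult_ac)
    have "?e t ^ n * cnj (?e t) ^ n = 1"
      by (simp flip: power_mult_distrib add: cis_cnj cis_mult)
    moreover have "vector_derivative (circlepath 0 r) (at t within {0..1}) = 2 * pi * \<i> * of_real r * ?e t"
      using that by (simp add: vector_derivative_circlepath01 e)
    moreover have "circlepath 0 r t = of_real r * ?e t"
      by (simp add: circlepath e)
    ultimately show ?thesis
      using assms by (simp add: field_simps)
  qed
  ultimately have "((\<lambda>t. f (of_real r * ?e t) * cnj (?e t) ^ n) has_integral
      of_real r ^ n / (2 * pi * \<i>) * ((2 * pi * \<i>) / fact n * (deriv ^^ n) f 0)) {0..1}"
    by (rule has_integral_eq[rotated])
  then show ?thesis
    by (simp add: field_simps)
qed

text \<open>Parseval's formula is replaced by testing \<open>w\<close> against its own Taylor polynomial \<open>T\<close>: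
  the mean of \<open>Re (w * cnj T) \<le> (1 + \<bar>T\<bar>\<^sup>2) / 2\<close> over the circle says
  \<open>S \<le> (1 + S) / 2\<close> for the sum \<open>S\<close> of the squared coefficients.\<close>

lemma bounded_taylor_coeffs_sum_squares_circle:
  fixes w :: "complex \<Rightarrow> complex"
  assumes holo: "w holomorphic_on ball 0 1" and bound: "\<And>z. z \<in> ball 0 1 \<Longrightarrow> cmod (w z) \<le> 1"
    and r: "0 < r" "r < 1"
  shows "(\<Sum>n\<le>N. (cmod ((deriv ^^ n) w 0 / fact n) * r ^ n)\<^sup>2) \<le> 1"
proof -
  define b where "b n = (deriv ^^ n) w 0 / fact n" for n
  define c where "c n = b n * of_real r ^ n" for n
  define T where "T z = (\<Sum>n\<le>N. b n * z ^ n)" for z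
  define S where "S = (\<Sum>n\<le>N. (cmod (c n))\<^sup>2)"
  define g where "g t = of_real r * cis (2 * pi * t)" for t
  have holoT: "T holomorphic_on ball 0 1"
    unfolding T_def by (intro holomorphic_intros)
  have coeffT: "(deriv ^^ n) T 0 / fact n = b n" if "n \<le> N" for n
  proof -
    \<comment> \<open>Padded with zeros, \<open>T\<close> is a power series, so uniqueness of the
      expansion yields its coefficients.\<close>
    have "(\<lambda>m. (if m \<in> {..N} then b m else 0) * z ^ m) sums T z" for z
      using sums_If_finite_set[of "{..N}" "\<lambda>m. b m * z ^ m"]
      by (simp add: T_def if_distrib[of "\<lambda>x. x * _"] cong: if_cong)
    then have "T has_fps_expansion Abs_fps (\<lambda>m. if m \<in> {..N} then b m else 0)"
      by (intro has_fps_expansionI) auto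
    from fps_nth_fps_expansion[OF this, of n] that show ?thesis by simp
  qed
  \<comment> \<open>Pairing with \<open>cnj T\<close> sees only the Taylor coefficients up to
    \<open>N\<close>. Hence \<open>w\<close> and \<open>T\<close>, which share them, give the same
    value \<open>S\<close>.\<close>
  have test: "((\<lambda>t. f (g t) * cnj (T (g t))) has_integral of_real S) {0..1}"
    if f: "f holomorphic_on ball 0 1" "\<And>n. n \<le> N \<Longrightarrow> (deriv ^^ n) f 0 / fact n = b n" for f
  proof -
    have "((\<lambda>t. cnj (c n) * (f (g t) * cnj (cis (2 * pi * t)) ^ n)) has_integral
        cnj (c n) * c n) {0..1}" if "n \<le> N" for n
      using circle_fourier_coeff[OF f(1) r, of n] f(2)[OF that]
      unfolding g_def c_def by (intro has_integral_mult_right) auto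
    then have "((\<lambda>t. \<Sum>n\<le>N. cnj (c n) * (f (g t) * cnj (cis (2 * pi * t)) ^ n)) has_integral
        (\<Sum>n\<le>N. cnj (c n) * c n)) {0..1}"
      by (intro has_integral_sum) auto
    moreover have "(\<Sum>n\<le>N. cnj (c n) * c n) = of_real S"
      unfolding S_def of_real_sum by (intro sum.cong) (auto simp: complex_norm_square mult.commute simp del: of_real_power)
    moreover have "(\<Sum>n\<le>N. cnj (c n) * (f (g t) * cnj (cis (2 * pi * t)) ^ n)) = f (g t) * cnj (T (g t))" for t
      by (simp add: T_def g_def c_def sum_distrib_left power_mult_distrib mult_ac)
    ultimately show ?thesis by simp
  qed
  have g: "g t \<in> ball 0 1" for t
    using r by (simp add: g_def norm_mult)
  have Re_test: "((\<lambda>t. Re (f (g t) * cnj (T (g t)))) has_integral S) {0..1}"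
    if "f holomorphic_on ball 0 1" "\<And>n. n \<le> N \<Longrightarrow> (deriv ^^ n) f 0 / fact n = b n" for f
    using has_integral_Re[OF test[OF that]] by simp
  have W: "((\<lambda>t. Re (w (g t) * cnj (T (g t)))) has_integral S) {0..1}"
    by (rule Re_test[OF holo]) (simp add: b_def)
  have TT: "((\<lambda>t. Re (T (g t) * cnj (T (g t)))) has_integral S) {0..1}"
    by (rule Re_test[OF holoT coeffT])
  have "((\<lambda>t. 1 / 2 + 1 / 2 * Re (T (g t) * cnj (T (g t)))) has_integral (1 / 2 + 1 / 2 * S)) {0..1}"
    using has_integral_add[OF has_integral_const_real[of "1/2" 0 1] has_integral_mult_right[OF TT, of "1/2"]]
    by simp
  then have "S \<le> 1 / 2 + 1 / 2 * S"
  proof (rule has_integral_le[OF W])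
    fix t :: real
    let ?x = "cmod (T (g t))"
    have "Re (w (g t) * cnj (T (g t))) \<le> cmod (w (g t) * cnj (T (g t)))"
      by (rule complex_Re_le_cmod)
    also have "\<dots> \<le> 1 * ?x"
      unfolding norm_mult complex_mod_cnj by (intro mult_right_mono bound g) auto
    also have "\<dots> \<le> 1 / 2 + 1 / 2 * ?x\<^sup>2"
      using zero_le_power2[of "?x - 1"] by (simp add: power2_diff)
    also have "?x\<^sup>2 = Re (T (g t) * cnj (T (g t)))"
      by (metis Re_complex_of_real complex_norm_square)
    finally show "Re (w (g t) * cnj (T (g t))) \<le> 1 / 2 + 1 / 2 * Re (T (g t) * cnj (T (g t)))" .
  qed
  then have "S \<le> 1" by simp
  then show ?thesis
    using r by (simp add: S_def c_def b_def norm_mult norm_power norm_divide)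
qed

text \<open>No boundary values of \<open>w\<close> are available, so the estimate is first made on
  circles of radius \<open>r < 1\<close>. The finite sum is continuous in \<open>r\<close>, which
  allows \<open>r\<close> to tend to 1.\<close>

lemma bounded_taylor_coeffs_sum_squares:
  fixes w :: "complex \<Rightarrow> complex"
  assumes "w holomorphic_on ball 0 1" "\<And>z. z \<in> ball 0 1 \<Longrightarrow> cmod (w z) \<le> 1"
  shows "(\<Sum>n\<le>N. (cmod ((deriv ^^ n) w 0 / fact n))\<^sup>2) \<le> 1"
proof -
  let ?S = "\<lambda>r::real. \<Sum>n\<le>N. (cmod ((deriv ^^ n) w 0 / fact n) * r ^ n)\<^sup>2"
  have "(?S \<longlongrightarrow> ?S 1) (at_left 1)"
    by (intro tendsto_intros)
  moreover have "\<forall>\<^sub>F r in at_left 1. ?S r \<le> 1"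
    using eventually_at_left_real[of 0 "1::real"]
    by (auto elim!: eventually_mono intro!: bounded_taylor_coeffs_sum_squares_circle[OF assms])
  ultimately have "?S 1 \<le> 1"
    by (rule tendsto_upperbound) simp
  then show ?thesis by simp
qed

text \<open>Bounding surplus factors by 1, or \<open>s * x\<close> by 1/2, makes every term
  quadratic. The mixed products are then split by AM-GM so that no square gets a coefficient above
  40.\<close>

lemma hankel_quadratic_bound:
  fixes s x y v :: real
  assumes nonneg: "0 \<le> s" "0 \<le> x" "0 \<le> y" "0 \<le> v" and sq: "s\<^sup>2 + x\<^sup>2 + y\<^sup>2 + v\<^sup>2 \<le> 1"
  shows "4 * s ^ 4 * x + 8 * s ^ 3 * y + 23 * s\<^sup>2 * x\<^sup>2 + 12 * s\<^sup>2 * v + 4 * s * x * y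
    + 20 * x ^ 3 + 24 * x * v + 20 * y\<^sup>2 \<le> 40"
proof -
  have "s\<^sup>2 \<le> 1\<^sup>2" "x\<^sup>2 \<le> 1\<^sup>2"
    using sq zero_le_power2[of s] zero_le_power2[of x] zero_le_power2[of y] zero_le_power2[of v]
    unfolding one_power2 by linarith+
  then have s1: "s \<le> 1" and x1: "x \<le> 1"
    by (auto intro: power2_le_imp_le)
  have le1: "p * q \<le> q" if "p \<le> 1" "0 \<le> q" for p q :: real
    using mult_right_mono[OF that] by simp
  have sx: "s * x \<le> 1 / 2"
    using sum_squares_bound[of s x] sq zero_le_power2[of y] zero_le_power2[of v] by linarith
  have "s ^ 4 * x \<le> s * x"
    using le1[OF power_le_one[of s 3], of "s * x"] nonneg s1 by (simp add: power4_eq_xxxx power3_eq_cube mult_ac)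
  moreover have "s ^ 3 * y \<le> s * y"
    using le1[OF power_le_one[of s 2], of "s * y"] nonneg s1 by (simp add: power2_eq_square power3_eq_cube mult_ac)
  moreover have "s\<^sup>2 * x\<^sup>2 \<le> s * x / 2"
    using mult_right_mono[OF sx, of "s * x"] nonneg by (simp add: power2_eq_square mult_ac)
  moreover have "s\<^sup>2 * v \<le> s * v"
    using le1[of s "s * v"] nonneg s1 by (simp add: power2_eq_square mult_ac)
  moreover have "s * x * y \<le> x * y"
    using le1[of s "x * y"] nonneg s1 by (simp add: mult_ac)
  moreover have "x ^ 3 \<le> x\<^sup>2"
    using le1[of x "x\<^sup>2"] nonneg x1 by (simp add: power2_eq_square power3_eq_cube)
  \<comment> \<open>The reductions leave 4 + 23/2 = 31/2 times \<open>s * x\<close>. The other terms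
    already use 20 + 2 + 12 = 34 of the 40 allowed for the square of \<open>x\<close>, so at most 6
    may be spent here; doubling gives the 12. The square below achieves this, as 961/48 <
    24.\<close>
  moreover have "31 * (s * x) \<le> 24 * s\<^sup>2 + 12 * x\<^sup>2"
  proof -
    have "(31 * s - 24 * x)\<^sup>2 = 961 * s\<^sup>2 - 1488 * (s * x) + 576 * x\<^sup>2"
      by (simp add: power2_diff power_mult_distrib)
    then show ?thesis
      using zero_le_power2[of "31 * s - 24 * x"] zero_le_power2[of s] by linarith
  qed
  moreover have "2 * (s * y) \<le> s\<^sup>2 + y\<^sup>2" "2 * (s * v) \<le> s\<^sup>2 + v\<^sup>2"
    "2 * (x * y) \<le> x\<^sup>2 + y\<^sup>2" "2 * (x * v) \<le> x\<^sup>2 + v\<^sup>2"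
    using sum_squares_bound[of s y] sum_squares_bound[of s v] sum_squares_bound[of x y]
      sum_squares_bound[of x v] by simp_all
  ultimately show ?thesis
    using sq zero_le_power2[of s] zero_le_power2[of x] zero_le_power2[of y] zero_le_power2[of v]
    unfolding mult.assoc by linarith
qed

text \<open>The condition on \<open>f\<close> says that \<open>q = z f'' / f'\<close> lies in the half-plane
  \<open>Re q > -3/2\<close>, which \<open>q / (q + 3)\<close> maps to the unit disk.\<close>

lemma ozaki_schwarz_function:
  fixes f :: "complex \<Rightarrow> complex"
  assumes "f \<in> ozaki_close_to_convex"
  obtains w where "w holomorphic_on ball 0 1" "\<And>z. z \<in> ball 0 1 \<Longrightarrow> cmod (w z) \<le> 1"
    "\<And>z. z \<in> ball 0 1 \<Longrightarrow> w z * (z * deriv (deriv f) z + 3 * deriv f z) = z * deriv (deriv f) z"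
proof -
  have holo: "f holomorphic_on ball 0 1"
    and ne: "\<And>z. z \<in> ball 0 1 \<Longrightarrow> deriv f z \<noteq> 0"
    and Re_gt: "\<And>z. z \<in> ball 0 1 \<Longrightarrow> Re (1 + z * deriv (deriv f) z / deriv f z) > - 1 / 2"
    using assms by (auto simp: ozaki_close_to_convex_def class_A_def)
  define q where "q z = z * deriv (deriv f) z / deriv f z" for z
  have hq: "q holomorphic_on ball 0 1"
    unfolding q_def using ne by (intro holomorphic_intros holo) auto
  have Re_q: "Re (q z) > - 3 / 2" if "z \<in> ball 0 1" for z
    using Re_gt[OF that] by (simp add: q_def)
  have q3: "q z + 3 \<noteq> 0" if "z \<in> ball 0 1" for z
    using Re_q[OF that] by (auto simp: complex_eq_iff)
  show thesis
  proof
    show "(\<lambda>z. q z / (q z + 3)) holomorphic_on ball 0 1"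
      using q3 by (intro holomorphic_intros hq) auto
    show "cmod (q z / (q z + 3)) \<le> 1" if "z \<in> ball 0 1" for z
    proof -
      \<comment> \<open>The difference of the two sides is 6 Re q + 9, which is positive.\<close>
      have "(cmod (q z))\<^sup>2 \<le> (cmod (q z + 3))\<^sup>2"
        using Re_q[OF that] unfolding cmod_power2 by (simp add: power2_sum)
      then have "cmod (q z) \<le> cmod (q z + 3)"
        by (rule power2_le_imp_le) simp
      then show ?thesis
        using q3[OF that] by (simp add: norm_divide divide_simps)
    qed
    show "q z / (q z + 3) * (z * deriv (deriv f) z + 3 * deriv f z) = z * deriv (deriv f) z"
      if "z \<in> ball 0 1" for z
    proof -
      have "z * deriv (deriv f) z = q z * deriv f z"
        using ne[OF that] by (simp add: q_def)
      moreover have "q z * deriv f z + 3 * deriv f z = (q z + 3) * deriv f z"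
        by (simp add: algebra_simps)
      ultimately show ?thesis using q3[OF that] by simp
    qed
  qed
qed

text \<open>Comparing coefficients in the quotient-free relation for the Schwarz function gives a
  recursion expressing each coefficient of \<open>f\<close> through earlier ones and the
  \<open>b k\<close>.\<close>

lemma ozaki_taylor_coeffs:
  fixes f :: "complex \<Rightarrow> complex" and a :: "nat \<Rightarrow> complex"
  assumes f: "f \<in> ozaki_close_to_convex"
    and a: "\<And>z. z \<in> ball 0 1 \<Longrightarrow> (\<lambda>n. a n * z ^ n) sums f z"
  obtains b :: "nat \<Rightarrow> complex" where "(\<Sum>n\<le>4. (cmod (b n))\<^sup>2) \<le> 1"
    "a 2 = 3 / 2 * b 1"
    "a 3 = 1 / 2 * b 2 + 2 * b 1 ^ 2"
    "a 4 = 1 / 4 * b 3 + 13 / 8 * b 1 * b 2 + 5 / 2 * b 1 ^ 3"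
    "a 5 = 3 / 20 * b 4 + 9 / 10 * b 1 * b 3 + 3 / 8 * b 2 ^ 2 + 69 / 20 * b 1 ^ 2 * b 2 + 3 * b 1 ^ 4"
proof -
  obtain w where holo: "w holomorphic_on ball 0 1"
    and bound: "\<And>z. z \<in> ball 0 1 \<Longrightarrow> cmod (w z) \<le> 1"
    and eq: "\<And>z. z \<in> ball 0 1 \<Longrightarrow>
      w z * (z * deriv (deriv f) z + 3 * deriv f z) = z * deriv (deriv f) z"
    using ozaki_schwarz_function[OF f] by blast
  define b where "b n = (deriv ^^ n) w 0 / fact n" for n
  define A where "A = Abs_fps a"
  define B where "B = fps_expansion w 0"
  have nhds: "\<forall>\<^sub>F z in nhds 0. z \<in> ball (0::complex) 1"
    by (intro eventually_nhds_in_open) auto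
  have A: "f has_fps_expansion A"
    by (rule has_fps_expansionI, rule eventually_mono[OF nhds]) (use a in \<open>simp add: A_def\<close>)
  have B: "w has_fps_expansion B"
    unfolding B_def using holo by (intro has_fps_expansion_fps_expansion[of "ball 0 1"]) auto
  have b: "fps_nth B n = b n" for n
    by (simp add: B_def b_def fps_expansion_def)
  let ?U = "fps_X * fps_deriv (fps_deriv A)"
  have U: "(\<lambda>z. z * deriv (deriv f) z) has_fps_expansion ?U"
    by (intro fps_expansion_intros A)
  have "(\<lambda>z. w z * (z * deriv (deriv f) z + 3 * deriv f z)) has_fps_expansion
      B * (?U + fps_const 3 * fps_deriv A)"
    by (intro fps_expansion_intros A B)
  \<comment> \<open>An expansion at 0 depends only on the germ, so the identity on the disk
    suffices.\<close>
  moreover have "(\<lambda>z. w z * (z * deriv (deriv f) z + 3 * deriv f z)) has_fps_expansion ?U"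
    using U by (subst has_fps_expansion_cong[OF eventually_mono[OF nhds eq] refl])
  ultimately have "B * (?U + fps_const 3 * fps_deriv A) = ?U"
    by (metis fps_nth_fps_expansion fps_ext)
  then have "fps_nth (B * (?U + fps_const 3 * fps_deriv A)) n = fps_nth ?U n" for n
    by simp
  moreover have "fps_nth ?U n = of_nat (n * (n + 1)) * a (n + 1)"
    and "fps_nth (?U + fps_const 3 * fps_deriv A) n = of_nat ((n + 3) * (n + 1)) * a (n + 1)" for n
    by (cases n; simp add: A_def algebra_simps)+
  ultimately have rec: "(\<Sum>k\<le>n. b k * (of_nat ((n - k + 3) * (n - k + 1)) * a (n - k + 1)))
      = of_nat (n * (n + 1)) * a (n + 1)" for n
    by (simp only: fps_mult_nth b atLeast0AtMost)
  have "deriv f 0 = 1"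
    using f by (simp add: ozaki_close_to_convex_def class_A_def)
  then have a1: "a 1 = 1"
    using fps_nth_fps_expansion[OF A, of 1] by (simp add: A_def)
  \<comment> \<open>This removes the term with \<open>a (n + 1)\<close> from the left side of
    \<open>rec\<close>, so that the recursion can be solved for it.\<close>
  have b0: "b 0 = 0"
    using rec[of 0] a1 by simp
  have a2: "a 2 = 3 / 2 * b 1"
    and rec2: "a 3 = (3 * b 2 + 8 * b 1 * a 2) / 6"
    and rec3: "a 4 = (3 * b 3 + 8 * b 2 * a 2 + 15 * b 1 * a 3) / 12"
    and rec4: "a 5 = (3 * b 4 + 8 * b 3 * a 2 + 15 * b 2 * a 3 + 24 * b 1 * a 4) / 20"
    using rec[of 1] rec[of 2] rec[of 3] rec[of 4] a1 b0
    by (simp_all add: numeral_eq_Suc field_simps)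
  have a3: "a 3 = 1 / 2 * b 2 + 2 * b 1 ^ 2"
    unfolding rec2 a2 by (simp add: field_simps power2_eq_square)
  have a4: "a 4 = 1 / 4 * b 3 + 13 / 8 * b 1 * b 2 + 5 / 2 * b 1 ^ 3"
    unfolding rec3 a2 a3 by (simp add: field_simps power2_eq_square power3_eq_cube)
  have a5: "a 5 = 3 / 20 * b 4 + 9 / 10 * b 1 * b 3 + 3 / 8 * b 2 ^ 2 + 69 / 20 * b 1 ^ 2 * b 2 + 3 * b 1 ^ 4"
    unfolding rec4 a2 a3 a4
    by (simp add: field_simps power2_eq_square power3_eq_cube power4_eq_xxxx)
  have "(\<Sum>n\<le>4. (cmod (b n))\<^sup>2) \<le> 1"
    unfolding b_def by (rule bounded_taylor_coeffs_sum_squares[OF holo bound])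
  then show thesis
    using that a2 a3 a4 a5 by blast
qed

theorem theorem1:
  fixes f :: "complex \<Rightarrow> complex" and a :: "nat \<Rightarrow> complex"
  assumes "f \<in> ozaki_close_to_convex"
    and "\<And>z. z \<in> ball 0 1 \<Longrightarrow> (\<lambda>n. a n * z ^ n) sums f z"
  shows "cmod (hankel_3_1 a) \<le> 1 / 8"
proof -
  obtain b :: "nat \<Rightarrow> complex" where sq: "(\<Sum>n\<le>4. (cmod (b n))\<^sup>2) \<le> 1"
    and coeffs: "a 2 = 3 / 2 * b 1" "a 3 = 1 / 2 * b 2 + 2 * b 1 ^ 2"
    "a 4 = 1 / 4 * b 3 + 13 / 8 * b 1 * b 2 + 5 / 2 * b 1 ^ 3"
    "a 5 = 3 / 20 * b 4 + 9 / 10 * b 1 * b 3 + 3 / 8 * b 2 ^ 2 + 69 / 20 * b 1 ^ 2 * b 2 + 3 * b 1 ^ 4"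
    using ozaki_taylor_coeffs[OF assms] by blast
  let ?s = "cmod (b 1)" and ?x = "cmod (b 2)" and ?y = "cmod (b 3)" and ?v = "cmod (b 4)"
  have "{..4} = {0, 1, 2, 3, 4::nat}"
    by auto
  then have "(\<Sum>n\<le>4. (cmod (b n))\<^sup>2) = (cmod (b 0))\<^sup>2 + (?s\<^sup>2 + ?x\<^sup>2 + ?y\<^sup>2 + ?v\<^sup>2)"
    by simp
  with sq have sq': "?s\<^sup>2 + ?x\<^sup>2 + ?y\<^sup>2 + ?v\<^sup>2 \<le> 1"
    using zero_le_power2[of "cmod (b 0)"] by linarith
  \<comment> \<open>The factor 320 clears all denominators. The pure power \<open>b 1 ^ 6\<close>
    cancels, so each monomial contains \<open>b 2\<close>, \<open>b 3\<close> or \<open>b 4\<close>.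
    Negative terms are written as summands to suit the triangle inequality.\<close>
  have eq: "320 * hankel_3_1 a = 4 * b 1 ^ 4 * b 2 + 8 * b 1 ^ 3 * b 3 + - (23 * b 1 ^ 2 * b 2 ^ 2)
      + - (12 * b 1 ^ 2 * b 4) + 4 * b 1 * b 2 * b 3 + 20 * b 2 ^ 3 + 24 * b 2 * b 4 + - (20 * b 3 ^ 2)"
    unfolding hankel_3_1_expand coeffs
    by (simp add: field_simps power2_eq_square power3_eq_cube power4_eq_xxxx)
  have "cmod (320 * hankel_3_1 a) \<le> 4 * ?s ^ 4 * ?x + 8 * ?s ^ 3 * ?y + 23 * ?s\<^sup>2 * ?x\<^sup>2 + 12 * ?s\<^sup>2 * ?v
      + 4 * ?s * ?x * ?y + 20 * ?x ^ 3 + 24 * ?x * ?v + 20 * ?y\<^sup>2"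
    unfolding eq by (intro norm_triangle_mono) (simp_all add: norm_mult norm_power)
  also have "\<dots> \<le> 40"
    using sq' by (intro hankel_quadratic_bound) auto
  finally show ?thesis
    by (simp add: norm_mult)
qed

end
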